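(* Let $n\ge 3$ be odd, let $\epsilon\in(0,1)$, and let $U=B_\epsilon(0):=\{x\in\mathbb{R}^n:|x|<\epsilon\}$. There exists a non-trivial (i.e. not identically zero) function $f\in C_c^\infty(\mathbb{B})$ such that $f$ vanishes in $U$ and $\mathcal{R}f(p,t)=0$ for all $p\in\mathbb{S}^{n-1}$ and all $t\in(1-\epsilon,1+\epsilon)$.
   Context: $\mathbb{B}$ is the (open) unit ball in $\mathbb{R}^n$ and $\mathbb{S}^{n-1}$ its boundary; $\omega_n$ is the surface area of $\mathbb{S}^{n-1}$ and $\mathrm dS$ its surface measure. For $f\in C_c^\infty(\mathbb{B})$ (extended by zero to $\mathbb{R}^n$), the spherical mean transform is $$\mathcal{R}f(p,t)=\frac1{\omega_n}\int_{\mathbb{S}^{n-1}} f(p+t\theta)\,\mathrm dS(\theta),\qquad p\in\mathbb{S}^{n-1},\ t\in(0,\infty).$$ *)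

theory Defs
  imports "HOL-Analysis.Analysis"
begin

definition partial_deriv :: "'a::euclidean_space \<Rightarrow> ('a \<Rightarrow> real) \<Rightarrow> 'a \<Rightarrow> real" where
  "partial_deriv b f x = deriv (\<lambda>h. f (x + h *\<^sub>R b)) 0"

text \<open>
  Meant for open \<open>S\<close>: all iterated partial derivatives of order at most \<open>k\<close>, in the coordinate
  directions, exist and are continuous on \<open>S\<close>.  Existence is required explicitly, since
  \<^const>\<open>deriv\<close> is total.
\<close>

primrec Ck_on :: "nat \<Rightarrow> 'a::euclidean_space set \<Rightarrow> ('a \<Rightarrow> real) \<Rightarrow> bool" where
  "Ck_on 0 S f \<longleftrightarrow> continuous_on S f"
| "Ck_on (Suc k) S f \<longleftrightarrow>
     continuous_on S f \<and>
     (\<forall>b\<in>Basis. (\<forall>x\<in>S. (\<lambda>h. f (x + h *\<^sub>R b)) differentiable (at 0)) \<and>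
                Ck_on k S (partial_deriv b f))"

definition smooth_on :: "'a::euclidean_space set \<Rightarrow> ('a \<Rightarrow> real) \<Rightarrow> bool" where
  "smooth_on S f \<longleftrightarrow> (\<forall>k. Ck_on k S f)"

text \<open>
  \<open>C\<^sub>c\<^sup>\<infinity>(S)\<close> for open \<open>S\<close>.  Its elements are represented by their extensions by zero to the
  whole space: the closed support, taken in the whole space, is a compact subset of \<open>S\<close>,
  so in particular the function vanishes outside \<open>S\<close>.
\<close>

definition test_functions :: "'a::euclidean_space set \<Rightarrow> ('a \<Rightarrow> real) set" where
  "test_functions S =
     {f. smooth_on S f \<and> compact (closure {x. f x \<noteq> 0}) \<and> closure {x. f x \<noteq> 0} \<subseteq> S}"

text \<open>
  The surface measure \<open>dS\<close> on the unit sphere, via polar coordinates: \<open>dx = r\<^bsup>n-1\<^esup> dr dS(\<theta>)\<close>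
  gives \<open>S(A) = n \<cdot> vol {r \<theta> | 0 < r < 1, \<theta> \<in> A}\<close> for Borel sets \<open>A\<close> in the sphere, that is,
  \<open>S\<close> is \<open>n\<close> times the image of Lebesgue measure on the punctured ball under radial projection.
\<close>

definition sphere_measure :: "'a::euclidean_space measure" where
  "sphere_measure =
     scale_measure (of_nat DIM('a))
       (distr (restrict_space lborel (ball 0 1 - {0 :: 'a}))
              (restrict_space borel (sphere 0 1))
              (\<lambda>x. x /\<^sub>R norm x))"

definition sphere_area :: "'a::euclidean_space itself \<Rightarrow> real" where
  "sphere_area _ = measure (sphere_measure :: 'a measure) (sphere 0 1)"

definition spherical_mean :: "('a::euclidean_space \<Rightarrow> real) \<Rightarrow> 'a \<Rightarrow> real \<Rightarrow> real" where
  "spherical_mean f p t =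
     1 / sphere_area TYPE('a) * (LINT \<theta>|sphere_measure. f (p + t *\<^sub>R \<theta>))"

end

theory Submission
  imports Defs "HOL-Real_Asymp.Real_Asymp"
begin

text \<open>
  The function \<open>f\<close> is radial, \<open>f(x) = G(|x|\<^sup>2)\<close>, where \<open>G\<close> is the derivative of order \<open>n - 2\<close> of a bump
  function \<open>\<phi>\<close> whose support \<open>[a, b]\<close> lies in \<open>(\<epsilon>\<^sup>2, 1)\<close>.  Such an \<open>f\<close> is smooth, it is supported in
  the shell \<open>a \<le> |x|\<^sup>2 \<le> b\<close>, which avoids the ball of radius \<open>\<epsilon>\<close>, and it is not identically zero, since
  a derivative of a compactly supported function vanishes only if the function does
  (\<open>deriv_funpow_bump_nonzero\<close>).

  For a unit vector \<open>p\<close> and a point \<open>\<theta>\<close> of the sphere, \<open>|p + t \<theta>|\<^sup>2 = 1 + t\<^sup>2 + 2 t s\<close> with \<open>s = p \<bullet> \<theta>\<close>.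
  On the sphere, \<open>s\<close> is distributed with a density proportional to \<open>(1 - s\<^sup>2)\<^bsup>(n - 3)/2\<^esup>\<close> on \<open>[-1, 1]\<close>.
  For odd \<open>n = 2 m + 3\<close> this density is a polynomial of degree \<open>2 m = n - 3\<close>, and the spherical mean
  is a multiple of
    \<open>\<integral> G(1 + t\<^sup>2 + 2 t s) (1 - s\<^sup>2)\<^bsup>m\<^esup> ds\<close>  over \<open>[-1, 1]\<close>.
  If \<open>|1 - t| < \<epsilon>\<close>, the argument of \<open>G\<close> runs from \<open>(1 - t)\<^sup>2 < \<epsilon>\<^sup>2\<close> to \<open>(1 + t)\<^sup>2 > 1\<close>, so it sweeps over the
  whole support of \<open>\<phi>\<close>.  Integrating by parts \<open>2 m + 1\<close> times produces no boundary terms and kills the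
  polynomial, so the mean is zero.

  The distribution of \<open>s\<close> is computed in the form \<open>nn_integral_sphere_zonal\<close>.  The surface measure
  comes from Lebesgue measure on the ball; invariance of Lebesgue measure under linear isometries
  (\<open>lborel_distr_isometry\<close>) allows \<open>p\<close> to be a basis vector, and cylindrical coordinates around it
  (\<open>nn_integral_lborel_cylindrical\<close>) reduce the claim to a scaling substitution.  The variable is the
  slope \<open>w\<close> with \<open>s = w / sqrt (1 + w\<^sup>2)\<close>, which ranges over the whole line.
\<close>

section \<open>A class of smooth functions\<close>

text \<open>
  The multiples by polynomials in \<open>1/x\<close> make the derivative of a flat function flat again, so that
  \<open>exp (-1/x)\<close> and all its derivatives are treated together.
\<close>

definition flat :: "real poly \<Rightarrow> real \<Rightarrow> real" where
  "flat p x = (if x \<le> 0 then 0 else poly p (1 / x) * exp (- (1 / x)))"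

lemma poly_mult_exp_minus_tendsto_0:
  fixes p :: "real poly"
  shows "((\<lambda>y. poly p y * exp (- y)) \<longlongrightarrow> 0) at_top"
proof -
  have "((\<lambda>y. \<Sum>i\<le>degree p. coeff p i * (y ^ i / exp y)) \<longlongrightarrow> 0) at_top"
    by (intro tendsto_null_sum tendsto_mult_right_zero tendsto_power_div_exp_0)
  then show ?thesis
    by (simp add: poly_altdef sum_distrib_right exp_minus divide_inverse mult.assoc)
qed

text \<open>
  Away from \<open>0\<close> this is the chain rule, the factor \<open>1/x\<^sup>2\<close> being the polynomial \<open>[:0, 0, 1:]\<close> at
  \<open>1/x\<close>.  At \<open>0\<close> the right difference quotient is \<open>q(y) exp (-y)\<close> with \<open>y = 1/h \<rightarrow> \<infinity>\<close> and
  \<open>q(y) = y p(y)\<close>, and the exponential beats the polynomial.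
\<close>

lemma DERIV_flat:
  "(flat p has_real_derivative flat ([:0, 0, 1:] * (p - pderiv p)) x) (at x)"
proof -
  consider "x < 0" | "x = 0" | "x > 0" by linarith
  then show ?thesis
  proof cases
    case 1
    have "((\<lambda>_. 0) has_real_derivative 0) (at x)" by simp
    then have "(flat p has_real_derivative 0) (at x)"
      by (rule has_field_derivative_transform_within_open[where S = "{..<0}"])
         (use 1 in \<open>auto simp: flat_def\<close>)
    then show ?thesis using 1 by (simp add: flat_def)
  next
    case 2
    have "((\<lambda>h. flat p h / h) \<longlongrightarrow> 0) (at_right 0)"
    proof (rule Lim_transform_eventually)
      show "((\<lambda>h. poly (pCons 0 p) (inverse h) * exp (- inverse h)) \<longlongrightarrow> 0) (at_right 0)"
        by (rule filterlim_compose[OF poly_mult_exp_minus_tendsto_0 filterlim_inverse_at_top_right])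
      show "\<forall>\<^sub>F h in at_right 0. poly (pCons 0 p) (inverse h) * exp (- inverse h) = flat p h / h"
        by (auto simp: eventually_at_filter flat_def field_simps)
    qed
    moreover have "((\<lambda>h. flat p h / h) \<longlongrightarrow> 0) (at_left 0)"
      by (rule tendsto_eventually) (auto simp: eventually_at_filter flat_def)
    ultimately have "((\<lambda>h. flat p h / h) \<longlongrightarrow> 0) (at 0)"
      by (simp add: filterlim_at_split)
    then show ?thesis
      by (simp add: 2 has_field_derivative_iff) (simp add: flat_def)
  next
    case 3
    have "((\<lambda>x. poly p (1 / x) * exp (- (1 / x))) has_real_derivative
        flat ([:0, 0, 1:] * (p - pderiv p)) x) (at x)"
      using 3
      by (auto intro!: derivative_eq_intros DERIV_chain2[OF poly_DERIV]
               simp: flat_def field_simps power2_eq_square)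
    then show ?thesis
      by (rule has_field_derivative_transform_within_open[where S = "{0<..}"])
         (use 3 in \<open>auto simp: flat_def\<close>)
  qed
qed

text \<open>
  A class of functions that is closed under partial derivatives and consists of continuous
  functions contains only smooth functions, so no induction over the order of differentiation has
  to be carried out for individual functions.  The class below is large enough for bump functions
  of the squared norm.
\<close>

inductive smooth_expr :: "('a::euclidean_space \<Rightarrow> real) \<Rightarrow> bool" where
  const: "smooth_expr (\<lambda>x. c)"
| inner: "smooth_expr (\<lambda>x. x \<bullet> v)"
| add: "smooth_expr f \<Longrightarrow> smooth_expr g \<Longrightarrow> smooth_expr (\<lambda>x. f x + g x)"
| mult: "smooth_expr f \<Longrightarrow> smooth_expr g \<Longrightarrow> smooth_expr (\<lambda>x. f x * g x)"
| flat: "smooth_expr f \<Longrightarrow> smooth_expr (\<lambda>x. flat p (f x))"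

lemma smooth_expr_continuous: "smooth_expr f \<Longrightarrow> continuous_on S f"
proof (induction rule: smooth_expr.induct)
  case (flat f p)
  have "continuous_on UNIV (flat p)"
    using DERIV_flat DERIV_isCont continuous_at_imp_continuous_on by blast
  then show ?case
    using flat.IH by (metis continuous_on_compose2 subset_UNIV)
qed (auto intro!: continuous_intros)

lemma smooth_expr_partial:
  assumes "smooth_expr f"
  shows "\<exists>f'. smooth_expr f' \<and> (\<forall>x. ((\<lambda>h. f (x + h *\<^sub>R b)) has_real_derivative f' x) (at 0))"
  using assms
proof (induction rule: smooth_expr.induct)
  case (const c)
  show ?case by (rule exI[of _ "\<lambda>_. 0"]) (auto intro: smooth_expr.intros)
next
  case (inner v)
  show ?case
    by (rule exI[of _ "\<lambda>_. b \<bullet> v"])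
       (auto intro: smooth_expr.intros simp: inner_add_left intro!: derivative_eq_intros)
next
  case (add f g)
  then obtain f' g' where
      "smooth_expr f'" "\<And>x. ((\<lambda>h. f (x + h *\<^sub>R b)) has_real_derivative f' x) (at 0)"
      "smooth_expr g'" "\<And>x. ((\<lambda>h. g (x + h *\<^sub>R b)) has_real_derivative g' x) (at 0)"
    by blast
  then show ?case
    by (intro exI[of _ "\<lambda>x. f' x + g' x"]) (auto intro: smooth_expr.intros DERIV_add)
next
  case (mult f g)
  then obtain f' g' where *:
      "smooth_expr f'" "\<And>x. ((\<lambda>h. f (x + h *\<^sub>R b)) has_real_derivative f' x) (at 0)"
      "smooth_expr g'" "\<And>x. ((\<lambda>h. g (x + h *\<^sub>R b)) has_real_derivative g' x) (at 0)"
    by blast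
  have "((\<lambda>h. f (x + h *\<^sub>R b) * g (x + h *\<^sub>R b)) has_real_derivative f' x * g x + g' x * f x) (at 0)" for x
    using DERIV_mult[OF *(2)[of x] *(4)[of x]] by simp
  then show ?case
    using * mult by (intro exI[of _ "\<lambda>x. f' x * g x + g' x * f x"]) (auto intro: smooth_expr.intros)
next
  case (flat f p)
  then obtain f' where *:
      "smooth_expr f'" "\<And>x. ((\<lambda>h. f (x + h *\<^sub>R b)) has_real_derivative f' x) (at 0)"
    by blast
  let ?q = "[:0, 0, 1:] * (p - pderiv p)"
  have "((\<lambda>h. flat p (f (x + h *\<^sub>R b))) has_real_derivative flat ?q (f x) * f' x) (at 0)" for x
    using DERIV_chain2[OF DERIV_flat *(2)[of x], of p] by simp
  then show ?case
    using * flat by (intro exI[of _ "\<lambda>x. flat ?q (f x) * f' x"] conjI allI smooth_expr.mult smooth_expr.flat)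
qed

lemma smooth_expr_imp_smooth_on:
  assumes "smooth_expr f"
  shows "smooth_on S f"
proof -
  have "Ck_on k S f" for k
    using assms
  proof (induction k arbitrary: f)
    case 0
    then show ?case by (simp add: smooth_expr_continuous)
  next
    case (Suc k)
    have "(\<forall>x\<in>S. (\<lambda>h. f (x + h *\<^sub>R b)) differentiable (at 0)) \<and> Ck_on k S (partial_deriv b f)" for b
    proof -
      obtain f' where f': "smooth_expr f'"
          "\<And>x. ((\<lambda>h. f (x + h *\<^sub>R b)) has_real_derivative f' x) (at 0)"
        using smooth_expr_partial[OF Suc.prems] by blast
      then have "partial_deriv b f = f'"
        by (intro ext) (simp add: partial_deriv_def DERIV_imp_deriv)
      with f' Suc.IH show ?thesis
        by (auto simp: real_differentiable_def)
    qed
    with Suc.prems show ?case by (simp add: smooth_expr_continuous)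
  qed
  then show ?thesis by (simp add: smooth_on_def)
qed

lemma smooth_expr_deriv:
  fixes f :: "real \<Rightarrow> real"
  assumes "smooth_expr f"
  shows "smooth_expr (deriv f)" and "(f has_real_derivative deriv f x) (at x)"
proof -
  obtain f' where f': "smooth_expr f'"
      "\<And>x. ((\<lambda>h. f (x + h *\<^sub>R 1)) has_real_derivative f' x) (at 0)"
    using smooth_expr_partial[OF assms] by blast
  have *: "(f has_real_derivative f' x) (at x)" for x
    using f'(2)[of x] DERIV_shift[of f "f' x" 0 x] by (simp add: add.commute)
  then have "deriv f = f'" by (auto intro!: DERIV_imp_deriv)
  with f'(1) * show "smooth_expr (deriv f)" "(f has_real_derivative deriv f x) (at x)" by simp_all
qed

lemma smooth_expr_deriv_funpow:
  fixes f :: "real \<Rightarrow> real"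
  assumes "smooth_expr f"
  shows "smooth_expr ((deriv ^^ k) f)"
  by (induction k) (simp_all add: assms smooth_expr_deriv)

lemma smooth_expr_compose:
  fixes g :: "real \<Rightarrow> real"
  assumes "smooth_expr g" and "smooth_expr f"
  shows "smooth_expr (\<lambda>x. g (f x))"
  using assms(1)
  by (induction rule: smooth_expr.induct) (auto intro: smooth_expr.intros assms(2))

lemma smooth_expr_sum:
  assumes "finite A" "\<And>i. i \<in> A \<Longrightarrow> smooth_expr (f i)"
  shows "smooth_expr (\<lambda>x. \<Sum>i\<in>A. f i x)"
  using assms by (induction rule: finite_induct) (auto intro: smooth_expr.intros)

lemma smooth_expr_inner_self: "smooth_expr (\<lambda>x::'a::euclidean_space. x \<bullet> x)"
proof -
  have "smooth_expr (\<lambda>x::'a. \<Sum>b\<in>Basis. (x \<bullet> b) * (x \<bullet> b))"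
    by (intro smooth_expr_sum smooth_expr.intros) auto
  then show ?thesis by (simp add: euclidean_inner[symmetric])
qed

definition bump :: "real \<Rightarrow> real \<Rightarrow> real \<Rightarrow> real" where
  "bump a b u = flat 1 ((u - a) * (b - u))"

lemma smooth_expr_bump: "smooth_expr (bump a b)"
proof -
  have "smooth_expr (\<lambda>u::real. flat 1 ((u \<bullet> 1 + - a) * (b + u \<bullet> - 1)))"
    by (intro smooth_expr.intros)
  then show ?thesis by (simp add: bump_def[abs_def] inner_real_def)
qed

lemma bump_eq_0: "u < a \<or> b < u \<Longrightarrow> a \<le> b \<Longrightarrow> bump a b u = 0"
  by (auto simp: bump_def flat_def mult_le_0_iff)

lemma deriv_funpow_eq_0:
  fixes f :: "real \<Rightarrow> real"
  assumes "open S" "\<And>u. u \<in> S \<Longrightarrow> f u = 0" "u \<in> S"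
  shows "(deriv ^^ k) f u = 0"
  using assms(3)
proof (induction k arbitrary: u)
  case (Suc k)
  have "((\<lambda>_. 0) has_real_derivative 0) (at u)" by simp
  then have "((deriv ^^ k) f has_real_derivative 0) (at u)"
    by (rule has_field_derivative_transform_within_open[OF _ assms(1) Suc.prems])
       (simp add: Suc.IH)
  then show ?case by (simp add: DERIV_imp_deriv)
qed (simp add: assms(2))

lemma deriv_funpow_bump_eq_0:
  assumes "a \<le> b" "u \<notin> {a..b}"
  shows "(deriv ^^ k) (bump a b) u = 0"
proof (rule deriv_funpow_eq_0[of "{..<a} \<union> {b<..}"])
  show "u \<in> {..<a} \<union> {b<..}" using assms(2) by auto
qed (use assms(1) in \<open>auto intro: bump_eq_0\<close>)

text \<open>
  If a derivative of order \<open>k + 1\<close> were identically zero, the derivative of order \<open>k\<close> would be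
  constant, hence zero, since it vanishes to the right of \<open>b\<close>.  Descending to \<open>k = 0\<close> would make the
  bump itself zero.
\<close>

lemma deriv_funpow_bump_nonzero:
  assumes "a < b"
  obtains u where "u \<in> {a..b}" "(deriv ^^ k) (bump a b) u \<noteq> 0"
proof -
  have "\<exists>u. (deriv ^^ k) (bump a b) u \<noteq> 0"
  proof (induction k)
    case 0
    have "(a + b) / 2 - a > 0" "b - (a + b) / 2 > 0" using assms by (auto simp: field_simps)
    then have "bump a b ((a + b) / 2) \<noteq> 0" by (auto simp: bump_def flat_def mult_le_0_iff)
    then show ?case by auto
  next
    case (Suc k)
    show ?case
    proof (rule ccontr)
      assume "\<not> ?thesis"
      then have "((deriv ^^ k) (bump a b) has_real_derivative 0) (at u)" for u
        using smooth_expr_deriv(2)[OF smooth_expr_deriv_funpow[OF smooth_expr_bump], of k a b u] by simp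
      then have "(deriv ^^ k) (bump a b) u = (deriv ^^ k) (bump a b) (b + 1)" for u
        by (metis DERIV_isconst_all)
      then have "(deriv ^^ k) (bump a b) u = 0" for u
        using deriv_funpow_bump_eq_0[of a b "b + 1" k] assms by simp
      with Suc.IH show False by simp
    qed
  qed
  then show ?thesis using that deriv_funpow_bump_eq_0[of a b _ k] assms by force
qed

section \<open>Invariance of Lebesgue measure under linear isometries\<close>

text \<open>
  The usual uniqueness argument for Haar measure: integrate \<open>1\<^sub>A(x) 1\<^sub>B(x + y)\<close>, with \<open>B\<close> the unit
  ball, over \<open>x\<close> with respect to \<open>M\<close> and over \<open>y\<close> with respect to Lebesgue measure.  Integrating
  over \<open>y\<close> first gives \<open>M(A) vol(B)\<close>; shifting \<open>x\<close> by \<open>- y\<close> before integrating over \<open>y\<close> gives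
  \<open>vol(A) M(B)\<close>.
\<close>

lemma translation_invariant_eq_lborel:
  fixes M :: "'a::euclidean_space measure"
  assumes [measurable_cong]: "sets M = sets borel"
    and inv: "\<And>c. distr M borel ((+) c) = M"
    and norm: "emeasure M (ball 0 1) = emeasure lborel (ball (0::'a) 1)"
    and "sigma_finite_measure M"
  shows "M = lborel"
proof (rule measure_eqI)
  fix A assume "A \<in> sets M"
  then have [measurable]: "A \<in> sets borel" using assms(1) by simp
  interpret M: sigma_finite_measure M by fact
  interpret P: pair_sigma_finite M lborel ..
  let ?B = "ball (0::'a) 1"
  have [measurable]: "?B \<in> sets borel" by simp
  have reflect: "distr lborel borel (\<lambda>y. x - y) = lborel" for x :: 'a
    using lborel_affine[of "-1" x] by (simp add: density_1)
  have b: "emeasure lborel ?B \<noteq> 0" "emeasure lborel ?B \<noteq> \<infinity>"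
    by (simp_all add: emeasure_ball less_imp_neq[symmetric])
  have "(\<integral>\<^sup>+x. \<integral>\<^sup>+y. indicator A x * indicator ?B (x + y) \<partial>lborel \<partial>M) =
        (\<integral>\<^sup>+x. indicator A x * (\<integral>\<^sup>+z. indicator ?B z \<partial>distr lborel borel ((+) x)) \<partial>M)"
    by (intro nn_integral_cong, subst nn_integral_distr) (simp_all add: nn_integral_cmult del: nn_integral_indicator)
  also have "\<dots> = emeasure M A * emeasure lborel ?B"
    by (simp add: lborel_distr_plus nn_integral_multc)
  finally have 1: "(\<integral>\<^sup>+x. \<integral>\<^sup>+y. indicator A x * indicator ?B (x + y) \<partial>lborel \<partial>M) =
      emeasure M A * emeasure lborel ?B" .
  have "(\<integral>\<^sup>+x. \<integral>\<^sup>+y. indicator A x * indicator ?B (x + y) \<partial>lborel \<partial>M) =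
        (\<integral>\<^sup>+y. \<integral>\<^sup>+x. indicator A x * indicator ?B (x + y) \<partial>M \<partial>lborel)"
    by (rule P.Fubini'[symmetric]) measurable
  also have "\<dots> = (\<integral>\<^sup>+y. \<integral>\<^sup>+x. indicator A x * indicator ?B (x + y) \<partial>distr M borel ((+) (- y)) \<partial>lborel)"
    by (simp only: inv)
  also have "\<dots> = (\<integral>\<^sup>+y. \<integral>\<^sup>+x. indicator A (x - y) * indicator ?B x \<partial>M \<partial>lborel)"
    by (simp add: nn_integral_distr)
  also have "\<dots> = (\<integral>\<^sup>+x. \<integral>\<^sup>+y. indicator A (x - y) * indicator ?B x \<partial>lborel \<partial>M)"
    by (rule P.Fubini') measurable
  also have "\<dots> = (\<integral>\<^sup>+x. (\<integral>\<^sup>+z. indicator A z \<partial>distr lborel borel (\<lambda>y. x - y)) * indicator ?B x \<partial>M)"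
    by (intro nn_integral_cong, subst nn_integral_distr)
       (simp_all add: nn_integral_multc del: nn_integral_indicator)
  also have "\<dots> = emeasure lborel A * emeasure M ?B"
    by (simp add: reflect nn_integral_cmult)
  finally show "emeasure M A = emeasure lborel A"
    using 1 b by (simp add: norm ennreal_mult_cancel_left mult.commute[of _ "emeasure lborel (ball 0 1)"])
qed (simp add: assms(1))

text \<open>
  The image measure is translation invariant because an isometry \<open>T\<close> is onto and turns the
  translation by \<open>d\<close> into the translation by \<open>T d\<close>, and it is normalised because \<open>T\<close> preserves the
  unit ball.
\<close>

lemma lborel_distr_isometry:
  fixes T :: "'a::euclidean_space \<Rightarrow> 'a"
  assumes T: "linear T" "\<And>x. norm (T x) = norm x"
  shows "distr lborel borel T = lborel"
proof (rule translation_invariant_eq_lborel)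
  have ball: "T -` ball 0 r = ball 0 r" for r
    using T by (auto simp: dist_norm)
  have "surj T"
    using T by (metis linear_injective_imp_surjective linear_injective_0 norm_eq_zero)
  have [measurable]: "T \<in> borel_measurable borel"
    using T(1) by (intro borel_measurable_continuous_onI linear_continuous_on linear_conv_bounded_linear[THEN iffD1])
  show "emeasure (distr lborel borel T) (ball 0 1) = emeasure lborel (ball (0::'a) 1)"
    by (simp add: emeasure_distr ball)
  show "distr (distr lborel borel T) borel ((+) c) = distr lborel borel T" for c
  proof -
    obtain d where d: "c = T d" using \<open>surj T\<close> by blast
    have "distr (distr lborel borel T) borel ((+) c) = distr lborel borel (T \<circ> (+) d)"
      using T(1) by (simp add: distr_distr d o_def linear_add)
    also have "\<dots> = distr (distr lborel borel ((+) d)) borel T"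
      by (simp add: distr_distr)
    finally show ?thesis by (simp add: lborel_distr_plus)
  qed
  show "sigma_finite_measure (distr lborel borel T)"
  proof
    have "(\<Union>n::nat. ball (0::'a) n) = UNIV"
      using reals_Archimedean2 by (auto simp: dist_norm)
    then show "\<exists>A. countable A \<and> A \<subseteq> sets (distr lborel borel T) \<and>
        \<Union> A = space (distr lborel borel T) \<and> (\<forall>a\<in>A. emeasure (distr lborel borel T) a \<noteq> \<infinity>)"
      by (intro exI[of _ "range (\<lambda>n::nat. ball 0 n)"])
         (auto simp: emeasure_distr ball emeasure_ball)
  qed
qed simp

text \<open>
  The Householder reflection along \<open>u - v\<close> exchanges \<open>u\<close> and \<open>v\<close>.
\<close>

lemma isometry_exists:
  fixes u v :: "'a::euclidean_space"
  assumes "norm u = norm v"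
  obtains T where "linear T" "\<And>x y. T x \<bullet> T y = x \<bullet> y" "T u = v"
proof (cases "u = v")
  case True
  then show ?thesis using that[of id] by (simp add: linear_id)
next
  case False
  define w where "w = u - v"
  define c where "c = 2 / (w \<bullet> w)"
  let ?T = "\<lambda>x. x - (c * (w \<bullet> x)) *\<^sub>R w"
  have w: "w \<bullet> w \<noteq> 0" using False by (simp add: w_def)
  have uv: "u \<bullet> u = v \<bullet> v" using assms by (simp add: norm_eq)
  show ?thesis
  proof (rule that[of ?T])
    show "linear ?T"
      by (rule linearI) (simp_all add: inner_add_right algebra_simps)
    show "?T x \<bullet> ?T y = x \<bullet> y" for x y
      using w by (simp add: inner_diff_left inner_diff_right c_def inner_commute field_simps)
    have "w \<bullet> w = 2 * (w \<bullet> u)"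
      by (simp add: w_def inner_diff_left inner_diff_right inner_commute uv)
    then have "c * (w \<bullet> u) = 1" using w by (simp add: c_def)
    then show "?T u = v" by (simp add: w_def)
  qed
qed

section \<open>Zonal functions on the sphere\<close>

text \<open>
  The ball of radius \<open>r\<close> in dimension \<open>d\<close> has volume proportional to \<open>r\<^bsup>d\<^esup>\<close>, and differentiating in
  \<open>r\<close> gives the density of the norm.  The coordinates are indexed by an arbitrary finite set because
  the lemma is needed on the orthogonal complement of a basis vector, which is not a type.
\<close>

lemma distr_PiM_lborel_l2_norm:
  fixes I :: "'i set"
  assumes "finite I" "I \<noteq> {}"
  defines "c \<equiv> card I * unit_ball_vol (card I)"
  shows "distr (\<Pi>\<^sub>M i\<in>I. lborel) borel (\<lambda>g. sqrt (\<Sum>i\<in>I. (g i)\<^sup>2)) =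
         density lborel (\<lambda>r. ennreal (c * r ^ (card I - 1)) * indicator {0..} r)"
    (is "?M = ?N")
proof (rule measure_eqI_generator_eq)
  define d where "d = card I"
  have d: "d > 0" using assms by (simp add: d_def card_gt_0_iff)
  have c: "c \<ge> 0" by (simp add: c_def)
  let ?P = "\<Pi>\<^sub>M i\<in>I. (lborel :: real measure)"
  let ?norm = "\<lambda>g::'i \<Rightarrow> real. sqrt (\<Sum>i\<in>I. (g i)\<^sup>2)"
  let ?E = "range (\<lambda>r::real. {..r})"
  show "Int_stable ?E"
    by (auto simp: Int_stable_def)
  show "?E \<subseteq> Pow UNIV" by simp
  show "sets ?M = sigma_sets UNIV ?E" "sets ?N = sigma_sets UNIV ?E"
    by (simp_all add: borel_eq_atMost)
  have M: "emeasure ?M {..r} = (if r \<le> 0 then 0 else ennreal (unit_ball_vol d * r ^ d))" for r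
  proof -
    have eq: "emeasure ?M {..r} = emeasure ?P ({g. ?norm g \<le> r} \<inter> space ?P)"
      by (subst emeasure_distr) (auto simp: vimage_def)
    consider "r < 0" | "r = 0" | "r > 0" by linarith
    then show ?thesis
    proof cases
      case 1
      have "0 \<le> ?norm g" for g by (simp add: sum_nonneg)
      with 1 have "\<not> ?norm g \<le> r" for g by (meson not_le order_less_le_trans)
      then show ?thesis using 1 eq by simp
    next
      case 2
      have "?norm g \<le> 0 \<longleftrightarrow> (\<Sum>i\<in>I. (g i)\<^sup>2) = 0" for g
        using sum_nonneg[of I "\<lambda>i. (g i)\<^sup>2"] by auto
      then have "?norm g \<le> 0 \<longleftrightarrow> (\<forall>i\<in>I. g i = 0)" for g
        using assms(1) by (simp add: sum_nonneg_eq_0_iff)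
      with 2 have "{g. ?norm g \<le> r} \<inter> space ?P = (\<Pi>\<^sub>E i\<in>I. {0})"
        by (auto simp: space_PiM PiE_iff fun_eq_iff restrict_def extensional_def)
      moreover have "emeasure ?P (\<Pi>\<^sub>E i\<in>I. {0}) = 0"
        using assms(1,2) by (subst product_sigma_finite.emeasure_PiM)
          (auto simp: product_sigma_finite_def sigma_finite_lborel)
      ultimately show ?thesis using 2 eq by simp
    next
      case 3
      then show ?thesis
        using eq emeasure_cball_aux[OF assms(1) 3] by (simp add: d_def)
    qed
  qed
  have N: "emeasure ?N {..r} = (if r \<le> 0 then 0 else ennreal (unit_ball_vol d * r ^ d))" for r
  proof -
    have "emeasure ?N {..r} = (\<integral>\<^sup>+x. ennreal (c * x ^ (d - 1)) * indicator {0..r} x \<partial>lborel)"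
      by (subst emeasure_density) (auto simp: d_def indicator_def intro!: nn_integral_cong)
    also have "\<dots> = (if r \<le> 0 then 0 else ennreal (unit_ball_vol d * r ^ d))"
    proof (cases "r \<le> 0")
      case True
      have "(\<integral>\<^sup>+x. ennreal (c * x ^ (d - 1)) * indicator {0..r} x \<partial>lborel) = (\<integral>\<^sup>+x. 0 \<partial>(lborel :: real measure))"
      proof (intro nn_integral_cong_AE)
        show "AE x in lborel. ennreal (c * x ^ (d - 1)) * indicator {0..r} x = 0"
          using AE_lborel_singleton[of 0]
          by eventually_elim (use True in \<open>auto split: split_indicator\<close>)
      qed
      then show ?thesis using True by simp
    next
      case False
      have "(\<integral>\<^sup>+x. ennreal (c * x ^ (d - 1)) * indicator {0..r} x \<partial>lborel) =
            ennreal (unit_ball_vol d * r ^ d - unit_ball_vol d * 0 ^ d)"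
        by (rule nn_integral_FTC_Icc)
           (use False c in \<open>auto simp: c_def d_def intro!: derivative_eq_intros\<close>)
      then show ?thesis using False d by simp
    qed
    finally show ?thesis .
  qed
  show "emeasure ?M X = emeasure ?N X" if "X \<in> ?E" for X
    using that M N by auto
  show "range (\<lambda>n::nat. {..real n}) \<subseteq> ?E" by auto
  show "(\<Union>n::nat. {..real n}) = UNIV"
    using real_arch_simple by auto
  show "emeasure ?M {..real n} \<noteq> \<infinity>" for n
    using M by simp
qed

text \<open>
  Cylindrical coordinates around the axis \<open>e\<close>: Fubini splits off the coordinate along \<open>e\<close>, and the
  distance from the axis is the norm of the remaining \<open>d\<close> coordinates.
\<close>

lemma nn_integral_lborel_cylindrical:
  fixes e :: "'a::euclidean_space" and h :: "real \<Rightarrow> real \<Rightarrow> ennreal"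
  assumes e: "e \<in> Basis" and dim: "DIM('a) = Suc d" "d > 0"
    and h[measurable]: "(\<lambda>(y, r). h y r) \<in> borel_measurable borel"
  shows "(\<integral>\<^sup>+x. h (x \<bullet> e) (norm (x - (x \<bullet> e) *\<^sub>R e)) \<partial>lborel) =
         (\<integral>\<^sup>+y. \<integral>\<^sup>+r. h y r * (ennreal (d * unit_ball_vol d * r ^ (d - 1)) * indicator {0..} r) \<partial>lborel \<partial>lborel)"
proof -
  interpret product_sigma_finite "\<lambda>_::'a. lborel :: real measure"
    by standard
  have [measurable]: "(\<lambda>(y, r). h y r) \<in> borel_measurable (borel \<Otimes>\<^sub>M borel)"
    using h by (simp add: borel_prod)
  define I where "I = Basis - {e}"
  have I: "finite I" "e \<notin> I" "Basis = insert e I" "card I = d"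
    using e dim by (auto simp: I_def)
  then have "I \<noteq> {}" using dim(2) by auto
  let ?P = "\<Pi>\<^sub>M i\<in>I. (lborel :: real measure)"
  let ?norm = "\<lambda>g::'a \<Rightarrow> real. sqrt (\<Sum>i\<in>I. (g i)\<^sup>2)"
  let ?x = "\<lambda>g. \<Sum>b\<in>Basis. g b *\<^sub>R b :: 'a"
  have x: "?x g \<bullet> e = g e" "norm (?x g - g e *\<^sub>R e) = ?norm g" for g
  proof -
    show "?x g \<bullet> e = g e" using e by simp
    have "?x g - g e *\<^sub>R e = (\<Sum>b\<in>I. g b *\<^sub>R b)"
      unfolding I(3) using I(1,2) by simp
    also have "norm \<dots> = ?norm g"
    proof -
      have "norm (\<Sum>b\<in>I. g b *\<^sub>R b) = sqrt (\<Sum>b\<in>I. (norm (g b *\<^sub>R b))\<^sup>2)"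
        using I(1) by (subst norm_sum_Pythagorean[symmetric])
          (auto simp: pairwise_def orthogonal_def I_def inner_not_same_Basis)
      also have "(\<Sum>b\<in>I. (norm (g b *\<^sub>R b))\<^sup>2) = (\<Sum>b\<in>I. (g b)\<^sup>2)"
        by (intro sum.cong) (auto simp: I_def)
      finally show ?thesis .
    qed
    finally show "norm (?x g - g e *\<^sub>R e) = ?norm g" .
  qed
  have "(\<integral>\<^sup>+x. h (x \<bullet> e) (norm (x - (x \<bullet> e) *\<^sub>R e)) \<partial>lborel) =
        (\<integral>\<^sup>+g. h (g e) (?norm g) \<partial>(\<Pi>\<^sub>M i\<in>insert e I. lborel))"
    by (subst lborel_eq) (simp add: nn_integral_distr x I(3)[symmetric])
  also have "\<dots> = (\<integral>\<^sup>+y. \<integral>\<^sup>+g. h y (?norm g) \<partial>?P \<partial>lborel)"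
  proof (subst product_nn_integral_insert_rev)
    have "(\<Sum>i\<in>I. ((g(e := y)) i)\<^sup>2) = (\<Sum>i\<in>I. (g i)\<^sup>2)" for g :: "'a \<Rightarrow> real" and y
      using I(2) by (intro sum.cong) auto
    then show "(\<integral>\<^sup>+y. \<integral>\<^sup>+g. h ((g(e := y)) e) (?norm (g(e := y))) \<partial>?P \<partial>lborel) =
          (\<integral>\<^sup>+y. \<integral>\<^sup>+g. h y (?norm g) \<partial>?P \<partial>lborel)"
      by simp
    show "(\<lambda>g. h (g e) (?norm g)) \<in> borel_measurable (\<Pi>\<^sub>M i\<in>insert e I. lborel)"
      by measurable
  qed (simp_all add: I(1,2))
  also have "\<dots> = (\<integral>\<^sup>+y. \<integral>\<^sup>+r. h y r \<partial>distr ?P borel ?norm \<partial>lborel)"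
    by (intro nn_integral_cong) (simp add: nn_integral_distr)
  also have "\<dots> = (\<integral>\<^sup>+y. \<integral>\<^sup>+r. h y r * (ennreal (d * unit_ball_vol d * r ^ (d - 1)) * indicator {0..} r) \<partial>lborel \<partial>lborel)"
    by (subst distr_PiM_lborel_l2_norm)
       (simp_all add: I \<open>I \<noteq> {}\<close> nn_integral_density mult.commute)
  finally show ?thesis .
qed

lemma nn_integral_sphere_measure:
  fixes g :: "'a::euclidean_space \<Rightarrow> ennreal"
  assumes [measurable]: "g \<in> borel_measurable borel"
  shows "(\<integral>\<^sup>+\<theta>. g \<theta> \<partial>sphere_measure) =
         DIM('a) * (\<integral>\<^sup>+x. g (x /\<^sub>R norm x) * indicator (ball 0 1 - {0}) x \<partial>lborel)"
proof -
  have *: "(\<lambda>x::'a. x /\<^sub>R norm x) \<in> restrict_space lborel (ball 0 1 - {0}) \<rightarrow>\<^sub>M restrict_space borel (sphere 0 1)"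
    by (intro measurable_restrict_space2 measurable_restrict_space1)
       (auto simp: space_restrict_space)
  have "(\<integral>\<^sup>+\<theta>. g \<theta> \<partial>sphere_measure) = DIM('a) *
        (\<integral>\<^sup>+x. g (x /\<^sub>R norm x) \<partial>restrict_space lborel (ball 0 1 - {0}))"
    unfolding sphere_measure_def
    by (subst nn_integral_scale_measure, simp add: measurable_restrict_space1, subst nn_integral_distr[OF *])
       (simp_all add: measurable_restrict_space1 ennreal_of_nat_eq_real_of_nat)
  then show ?thesis
    by (simp add: nn_integral_restrict_space)
qed

text \<open>
  In cylindrical coordinates \<open>(y, r)\<close> the integrand depends on the slope \<open>w = y / r\<close> and on the
  distance \<open>r sqrt (1 + w\<^sup>2)\<close> from the origin only.  Substituting \<open>y = r w\<close> for fixed \<open>r\<close> and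
  integrating over \<open>r\<close> last leaves the integral of \<open>r\<^bsup>d\<^esup>\<close> from \<open>0\<close> to \<open>1 / sqrt (1 + w\<^sup>2)\<close>.  Using the
  slope, that is the gnomonic coordinate, instead of \<open>s = w / sqrt (1 + w\<^sup>2)\<close> reduces the change of
  variables to a scaling of the line.
\<close>

lemma nn_integral_ball_zonal_Basis:
  fixes e :: "'a::euclidean_space" and H :: "real \<Rightarrow> ennreal"
  assumes e: "e \<in> Basis" and dim: "DIM('a) = Suc d" "d > 0"
    and [measurable]: "H \<in> borel_measurable borel"
  shows "DIM('a) * (\<integral>\<^sup>+x. H ((e \<bullet> x) / norm x) * indicator (ball 0 1 - {0}) x \<partial>lborel) =
    (\<integral>\<^sup>+w. H (w / sqrt (1 + w\<^sup>2)) * ennreal (d * unit_ball_vol d / sqrt (1 + w\<^sup>2) ^ Suc d) \<partial>lborel)"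
proof -
  define c where "c = d * unit_ball_vol d"
  have c: "c \<ge> 0" by (simp add: c_def)
  define h where "h y r = H (y / sqrt (y\<^sup>2 + r\<^sup>2)) * indicator {0<..<1} (sqrt (y\<^sup>2 + r\<^sup>2))" for y r
  define K where "K r = ennreal (c * r ^ (d - 1)) * indicator {0..} r" for r
  define S where "S w = sqrt (1 + w\<^sup>2)" for w :: real
  have S: "S w > 0" for w by (simp add: S_def add_pos_nonneg)
  have [measurable]: "S \<in> borel_measurable borel" "K \<in> borel_measurable borel"
    unfolding S_def[abs_def] K_def[abs_def] by measurable
  have h[measurable]: "(\<lambda>(y, r). h y r) \<in> borel_measurable (borel \<Otimes>\<^sub>M borel)"
    unfolding h_def by measurable
  have norm: "norm x = sqrt ((x \<bullet> e)\<^sup>2 + (norm (x - (x \<bullet> e) *\<^sub>R e))\<^sup>2)" for x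
  proof -
    have "(norm x)\<^sup>2 = (x \<bullet> e)\<^sup>2 + (norm (x - (x \<bullet> e) *\<^sub>R e))\<^sup>2"
      using e unfolding power2_norm_eq_inner
      by (simp add: inner_diff_left inner_diff_right inner_commute power2_eq_square)
    then show ?thesis by (metis norm_ge_zero real_sqrt_unique)
  qed
  \<comment> \<open>for fixed \<open>r\<close>, the substitution \<open>y = r w\<close>\<close>
  have scale: "\<integral>\<^sup>+y. h y r \<partial>lborel = r * (\<integral>\<^sup>+w. H (w / S w) * indicator {0<..<1} (r * S w) \<partial>lborel)"
    if r: "r > 0" for r
  proof -
    have "sqrt ((r * w)\<^sup>2 + r\<^sup>2) = r * S w" for w
    proof -
      have "(r * w)\<^sup>2 + r\<^sup>2 = r\<^sup>2 * (1 + w\<^sup>2)" by (simp add: algebra_simps)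
      then show ?thesis using r by (simp add: S_def real_sqrt_mult)
    qed
    then have "h (r * w) r = H (w / S w) * indicator {0<..<1} (r * S w)" for w
      using r by (simp add: h_def)
    then show ?thesis
      using r by (subst nn_integral_real_affine[of _ r 0]) simp_all
  qed
  \<comment> \<open>the extra factor \<open>r\<close> comes from \<open>dy = r dw\<close> and raises the exponent \<open>d - 1\<close> of \<open>K\<close> to \<open>d\<close>\<close>
  have radial: "(\<integral>\<^sup>+r. K r * (ennreal r * indicator {0<..<1} (r * S w)) \<partial>lborel) = ennreal (c / Suc d / S w ^ Suc d)" for w
  proof -
    have "(\<integral>\<^sup>+r. K r * (ennreal r * indicator {0<..<1} (r * S w)) \<partial>lborel) =
          (\<integral>\<^sup>+r. ennreal (c * r ^ d) * indicator {0..1 / S w} r \<partial>lborel)"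
      using AE_lborel_singleton[of "1 / S w"]
    proof (intro nn_integral_cong_AE, eventually_elim)
      fix r assume r: "r \<noteq> 1 / S w"
      show "K r * (ennreal r * indicator {0<..<1} (r * S w)) = ennreal (c * r ^ d) * indicator {0..1 / S w} r"
        using r S[of w] c dim(2) power_minus_mult[of d r]
        by (cases "r > 0"; cases "r = 0")
           (auto simp: K_def ennreal_mult'[symmetric] field_simps split: split_indicator)
    qed
    also have "\<dots> = ennreal (c / Suc d * (1 / S w) ^ Suc d - c / Suc d * 0 ^ Suc d)"
    proof (rule nn_integral_FTC_Icc)
      show "((\<lambda>r. c / Suc d * r ^ Suc d) has_real_derivative c * r ^ d) (at r)" for r
        using DERIV_cmult[OF DERIV_pow[of "Suc d" r], of "c / Suc d"] by (simp del: of_nat_Suc power_Suc)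
    qed (use S[of w] c in auto)
    also have "\<dots> = ennreal (c / Suc d / S w ^ Suc d)"
      by (simp add: power_divide)
    finally show ?thesis .
  qed
  have "(\<integral>\<^sup>+x. H ((e \<bullet> x) / norm x) * indicator (ball 0 1 - {0}) x \<partial>lborel) =
        (\<integral>\<^sup>+x. h (x \<bullet> e) (norm (x - (x \<bullet> e) *\<^sub>R e)) \<partial>lborel)"
    by (intro nn_integral_cong) (auto simp: h_def norm[symmetric] inner_commute split: split_indicator)
  also have "\<dots> = (\<integral>\<^sup>+y. \<integral>\<^sup>+r. h y r * K r \<partial>lborel \<partial>lborel)"
    using h unfolding K_def c_def
    by (intro nn_integral_lborel_cylindrical e dim) (simp add: borel_prod)
  also have "\<dots> = (\<integral>\<^sup>+r. \<integral>\<^sup>+y. h y r * K r \<partial>lborel \<partial>lborel)"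
    by (rule lborel_pair.Fubini'[symmetric]) measurable
  also have "\<dots> = (\<integral>\<^sup>+r. \<integral>\<^sup>+w. H (w / S w) * (K r * (ennreal r * indicator {0<..<1} (r * S w))) \<partial>lborel \<partial>lborel)"
    using AE_lborel_singleton[of 0]
  proof (intro nn_integral_cong_AE, eventually_elim)
    fix r :: real assume "r \<noteq> 0"
    then consider "r < 0" | "r > 0" by linarith
    then show "(\<integral>\<^sup>+y. h y r * K r \<partial>lborel) =
        (\<integral>\<^sup>+w. H (w / S w) * (K r * (ennreal r * indicator {0<..<1} (r * S w))) \<partial>lborel)"
    proof cases
      case 1
      then show ?thesis by (simp add: K_def)
    next
      case 2
      have "(\<integral>\<^sup>+y. h y r * K r \<partial>lborel) =
          r * (\<integral>\<^sup>+w. H (w / S w) * indicator {0<..<1} (r * S w) \<partial>lborel) * K r"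
        by (simp add: nn_integral_multc scale[OF 2])
      also have "\<dots> = (\<integral>\<^sup>+w. r * (H (w / S w) * indicator {0<..<1} (r * S w)) * K r \<partial>lborel)"
        by (simp add: nn_integral_multc nn_integral_cmult)
      finally show ?thesis by (simp add: mult_ac)
    qed
  qed
  also have "\<dots> = (\<integral>\<^sup>+w. \<integral>\<^sup>+r. H (w / S w) * (K r * (ennreal r * indicator {0<..<1} (r * S w))) \<partial>lborel \<partial>lborel)"
    by (rule lborel_pair.Fubini') measurable
  also have "\<dots> = (\<integral>\<^sup>+w. H (w / S w) * ennreal (c / Suc d / S w ^ Suc d) \<partial>lborel)"
    by (simp add: nn_integral_cmult radial)
  finally have "DIM('a) * (\<integral>\<^sup>+x. H ((e \<bullet> x) / norm x) * indicator (ball 0 1 - {0}) x \<partial>lborel) =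
      (\<integral>\<^sup>+w. ennreal DIM('a) * (H (w / S w) * ennreal (c / Suc d / S w ^ Suc d)) \<partial>lborel)"
    by (simp add: nn_integral_cmult ennreal_of_nat_eq_real_of_nat)
  also have "\<dots> = (\<integral>\<^sup>+w. H (w / S w) * ennreal (c / S w ^ Suc d) \<partial>lborel)"
  proof (intro nn_integral_cong)
    fix w
    have "ennreal DIM('a) * ennreal (c / Suc d / S w ^ Suc d) = ennreal (c / S w ^ Suc d)"
      using c S[of w] dim(1) by (simp add: ennreal_mult'[symmetric] del: of_nat_Suc)
    then show "ennreal DIM('a) * (H (w / S w) * ennreal (c / Suc d / S w ^ Suc d)) =
        H (w / S w) * ennreal (c / S w ^ Suc d)"
      by (metis mult.left_commute)
  qed
  finally show ?thesis by (simp add: c_def S_def)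
qed

text \<open>
  The theorem of Archimedes on zonal integrals.  The constant is the area of the unit sphere in
  dimension \<open>d\<close>, and \<open>s = w / sqrt (1 + w\<^sup>2)\<close> turns the right-hand side into the familiar integral of
  \<open>H(s) (1 - s\<^sup>2)\<^bsup>(d - 2)/2\<^esup>\<close> over \<open>[-1, 1]\<close>.
\<close>

lemma nn_integral_sphere_zonal:
  fixes p :: "'a::euclidean_space" and H :: "real \<Rightarrow> ennreal"
  assumes p: "norm p = 1" and dim: "DIM('a) = Suc d" "d > 0"
    and [measurable]: "H \<in> borel_measurable borel"
  shows "(\<integral>\<^sup>+\<theta>. H (p \<bullet> \<theta>) \<partial>sphere_measure) =
    (\<integral>\<^sup>+w. H (w / sqrt (1 + w\<^sup>2)) * ennreal (d * unit_ball_vol d / sqrt (1 + w\<^sup>2) ^ Suc d) \<partial>lborel)"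
proof -
  obtain e :: 'a where e: "e \<in> Basis" using nonempty_Basis by blast
  then obtain T where T: "linear T" "\<And>x y. T x \<bullet> T y = x \<bullet> y" "T e = p"
    using isometry_exists[of e p] p by auto
  have [measurable]: "ball 0 1 - {0::'a} \<in> sets borel" by simp
  have norm: "norm (T x) = norm x" for x
    by (simp add: norm_eq_sqrt_inner T(2))
  have [measurable]: "T \<in> borel_measurable borel"
    using T(1) by (intro borel_measurable_continuous_onI linear_continuous_on linear_conv_bounded_linear[THEN iffD1])
  have "(\<integral>\<^sup>+\<theta>. H (p \<bullet> \<theta>) \<partial>sphere_measure) =
      DIM('a) * (\<integral>\<^sup>+x. H ((p \<bullet> x) / norm x) * indicator (ball 0 1 - {0}) x \<partial>distr lborel borel T)"
    by (simp add: nn_integral_sphere_measure lborel_distr_isometry[OF T(1) norm] divide_inverse mult.commute)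
  also have "\<dots> = DIM('a) * (\<integral>\<^sup>+x. H ((e \<bullet> x) / norm x) * indicator (ball 0 1 - {0}) x \<partial>lborel)"
  proof -
    have "indicator (ball 0 1 - {0}) (T x) = (indicator (ball 0 1 - {0}) x :: ennreal)" for x
      using norm[of x] by (auto simp: indicator_def)
    moreover have "p \<bullet> T x = e \<bullet> x" for x
      using T(2)[of e x] T(3) by simp
    ultimately show ?thesis
      by (subst nn_integral_distr) (simp_all add: norm)
  qed
  finally show ?thesis
    by (simp only: nn_integral_ball_zonal_Basis[OF e dim \<open>H \<in> _\<close>])
qed

text \<open>
  As an equality of image measures, the formula carries over to integrands of either sign.
\<close>

lemma distr_sphere_measure_inner:
  fixes p :: "'a::euclidean_space"
  assumes p: "norm p = 1" and dim: "DIM('a) = Suc d" "d > 0"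
  shows "distr sphere_measure borel ((\<bullet>) p) =
    distr (density lborel (\<lambda>w. ennreal (d * unit_ball_vol d / sqrt (1 + w\<^sup>2) ^ Suc d))) borel
      (\<lambda>w. w / sqrt (1 + w\<^sup>2))"
proof (rule measure_eqI)
  fix A assume "A \<in> sets (distr sphere_measure borel ((\<bullet>) p))"
  then have [measurable]: "A \<in> sets borel" by simp
  have [measurable]: "(\<bullet>) p \<in> borel_measurable sphere_measure"
    unfolding sphere_measure_def by (simp add: measurable_restrict_space1 cong: measurable_cong_sets)
  have "emeasure (distr sphere_measure borel ((\<bullet>) p)) A = (\<integral>\<^sup>+\<theta>. indicator A (p \<bullet> \<theta>) \<partial>sphere_measure)"
    by (subst nn_integral_indicator[symmetric], simp, subst nn_integral_distr) simp_all
  also have "\<dots> = (\<integral>\<^sup>+w. indicator A w \<partial>distr (density lborel (\<lambda>w. ennreal (d * unit_ball_vol d / sqrt (1 + w\<^sup>2) ^ Suc d))) borel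
      (\<lambda>w. w / sqrt (1 + w\<^sup>2)))"
    by (subst nn_integral_sphere_zonal[OF p dim], simp, subst nn_integral_distr)
       (simp_all add: nn_integral_density mult.commute del: power_Suc)
  finally show "emeasure (distr sphere_measure borel ((\<bullet>) p)) A =
      emeasure (distr (density lborel (\<lambda>w. ennreal (d * unit_ball_vol d / sqrt (1 + w\<^sup>2) ^ Suc d))) borel
        (\<lambda>w. w / sqrt (1 + w\<^sup>2))) A"
    by simp
qed simp

lemma integral_sphere_zonal:
  fixes p :: "'a::euclidean_space" and H :: "real \<Rightarrow> real"
  assumes p: "norm p = 1" and dim: "DIM('a) = Suc d" "d > 0"
    and [measurable]: "H \<in> borel_measurable borel"
  shows "(LINT \<theta>|sphere_measure. H (p \<bullet> \<theta>)) =
    d * unit_ball_vol d * (LINT w|lborel. H (w / sqrt (1 + w\<^sup>2)) / sqrt (1 + w\<^sup>2) ^ Suc d)"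
proof -
  have [measurable]: "(\<bullet>) p \<in> borel_measurable sphere_measure"
    unfolding sphere_measure_def by (simp add: measurable_restrict_space1 cong: measurable_cong_sets)
  have "(LINT \<theta>|sphere_measure. H (p \<bullet> \<theta>)) = (LINT s|distr sphere_measure borel ((\<bullet>) p). H s)"
    by (simp add: integral_distr)
  also have "\<dots> = (LINT w|lborel. d * unit_ball_vol d / sqrt (1 + w\<^sup>2) ^ Suc d * H (w / sqrt (1 + w\<^sup>2)))"
    by (simp add: distr_sphere_measure_inner[OF p dim] integral_distr integral_density del: power_Suc)
  also have "\<dots> = (LINT w|lborel. d * unit_ball_vol d * (H (w / sqrt (1 + w\<^sup>2)) / sqrt (1 + w\<^sup>2) ^ Suc d))"
    by (simp add: mult_ac del: power_Suc)
  also have "\<dots> = d * unit_ball_vol d * (LINT w|lborel. H (w / sqrt (1 + w\<^sup>2)) / sqrt (1 + w\<^sup>2) ^ Suc d)"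
    by (rule integral_mult_right_zero)
  finally show ?thesis .
qed

text \<open>
  Integrating the constant \<open>1\<close> over the sphere shows that the weight has finite mass.
\<close>

lemma integrable_gnomonic:
  fixes H :: "real \<Rightarrow> real"
  assumes dim: "DIM('a::euclidean_space) = Suc d" "d > 0"
    and [measurable]: "H \<in> borel_measurable borel" and H: "\<And>s. \<bar>H s\<bar> \<le> B"
  shows "integrable lborel (\<lambda>w. H (w / sqrt (1 + w\<^sup>2)) / sqrt (1 + w\<^sup>2) ^ Suc d)"
proof -
  obtain p :: 'a where p: "norm p = 1" using nonempty_Basis norm_Basis by blast
  define c where "c = d * unit_ball_vol d"
  have c: "c > 0" using dim by (simp add: c_def)
  have "(\<integral>\<^sup>+w. ennreal (c / sqrt (1 + w\<^sup>2) ^ Suc d) \<partial>lborel) = (\<integral>\<^sup>+\<theta>. 1 \<partial>(sphere_measure :: 'a measure))"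
    using nn_integral_sphere_zonal[OF p dim, of "\<lambda>_. 1"] by (simp add: c_def)
  also have "\<dots> = DIM('a) * emeasure lborel (ball (0::'a) 1 - {0})"
    by (subst nn_integral_sphere_measure) simp_all
  also have "\<dots> \<le> DIM('a) * emeasure lborel (ball (0::'a) 1)"
    by (intro mult_left_mono emeasure_mono) auto
  also have "\<dots> < \<infinity>"
    by (simp add: emeasure_ball ennreal_mult_less_top ennreal_of_nat_eq_real_of_nat)
  finally have "integrable lborel (\<lambda>w. c / sqrt (1 + w\<^sup>2) ^ Suc d)"
    using c by (intro integrableI_nonneg) auto
  then have "integrable lborel (\<lambda>w. B / c * (c / sqrt (1 + w\<^sup>2) ^ Suc d))"
    by (rule integrable_mult_right)
  moreover have "\<bar>H s\<bar> \<le> \<bar>B\<bar>" for s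
    using order_trans[OF H abs_ge_self] .
  ultimately show ?thesis
    using c by (elim Bochner_Integration.integrable_bound) (auto intro!: AE_I2 divide_right_mono)
qed

section \<open>Integration by parts against the zonal weight\<close>

text \<open>
  Repeated integration by parts: each step moves one derivative from \<open>D (Suc k)\<close> to \<open>P\<close>, and the
  process stops because \<open>P\<close> has degree at most \<open>k\<close>.  The antiderivative is built from products with
  the \<open>D j\<close>, so it vanishes wherever all of these do; this is what makes the boundary terms
  disappear.
\<close>

lemma antiderivative_poly_mult_iterated_deriv:
  fixes P :: "real poly" and D :: "nat \<Rightarrow> real \<Rightarrow> real"
  assumes D: "\<And>j s. (D j has_real_derivative D (Suc j) s) (at s)" and "degree P \<le> k"
  obtains Q where "\<And>s. (Q has_real_derivative poly P s * D (Suc k) s) (at s)"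
    and "\<And>s. (\<And>j. D j s = 0) \<Longrightarrow> Q s = 0"
proof -
  have "\<exists>Q. (\<forall>s. (Q has_real_derivative poly P s * D (Suc k) s) (at s)) \<and>
            (\<forall>s. (\<forall>j. D j s = 0) \<longrightarrow> Q s = 0)"
    using assms(2)
  proof (induction k arbitrary: P)
    case 0
    then obtain c where c: "P = [:c:]" by (auto elim: degree_eq_zeroE)
    show ?case
      using DERIV_cmult[OF D[of 0], of c] by (intro exI[of _ "\<lambda>s. c * D 0 s"]) (auto simp: c)
  next
    case (Suc k)
    have "degree (pderiv P) \<le> k" using Suc.prems by (simp add: degree_pderiv)
    with Suc.IH obtain R where R: "\<And>s. (R has_real_derivative poly (pderiv P) s * D (Suc k) s) (at s)"
        "\<And>s. (\<forall>j. D j s = 0) \<Longrightarrow> R s = 0"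
      by blast
    have "((\<lambda>s. poly P s * D (Suc k) s - R s) has_real_derivative poly P s * D (Suc (Suc k)) s) (at s)" for s
      by (rule derivative_eq_intros R(1) D poly_DERIV refl | simp)+
    with R(2) show ?case by (intro exI[of _ "\<lambda>s. poly P s * D (Suc k) s - R s"]) auto
  qed
  with that show ?thesis by blast
qed

text \<open>
  With \<open>s = w / sqrt (1 + w\<^sup>2)\<close> one has \<open>1 - s\<^sup>2 = 1 / (1 + w\<^sup>2)\<close> and \<open>ds/dw = (1 + w\<^sup>2)\<^bsup>-3/2\<^esup>\<close>, so the
  integrand is the derivative of \<open>Q\<close> along \<open>w\<close>, and \<open>w \<rightarrow> \<plusminus>\<infinity>\<close> corresponds to \<open>s \<rightarrow> \<plusminus>1\<close>.
\<close>

lemma integral_gnomonic_eq_0: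
  fixes H Q :: "real \<Rightarrow> real"
  assumes Q: "\<And>s. (Q has_real_derivative (1 - s\<^sup>2) ^ m * H s) (at s)" "Q 1 = 0" "Q (- 1) = 0"
    and H: "\<And>s. isCont H s"
    and int: "integrable lborel (\<lambda>w. H (w / sqrt (1 + w\<^sup>2)) / sqrt (1 + w\<^sup>2) ^ (2 * m + 3))"
  shows "(LINT w|lborel. H (w / sqrt (1 + w\<^sup>2)) / sqrt (1 + w\<^sup>2) ^ (2 * m + 3)) = 0"
proof -
  define S where "S w = sqrt (1 + w\<^sup>2)" for w :: real
  have S: "S w > 0" "(S w)\<^sup>2 = 1 + w\<^sup>2" for w by (simp_all add: S_def add_pos_nonneg)
  let ?f = "\<lambda>w. H (w / S w) / S w ^ (2 * m + 3)"
  have S': "(S has_real_derivative w / S w) (at w)" for w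
  proof -
    have "1 + w\<^sup>2 > 0" by (simp add: add_pos_nonneg)
    then show ?thesis
      unfolding S_def[abs_def] by (auto intro!: derivative_eq_intros simp: field_simps)
  qed
  have s': "((\<lambda>w. w / S w) has_real_derivative 1 / S w ^ 3) (at w)" for w
  proof (rule derivative_eq_intros S' refl)+
    have "S w * S w = 1 + w * w" using S(2)[of w] by (simp add: power2_eq_square)
    then show "(1 * S w - w * (w / S w)) / (S w * S w) = 1 / S w ^ 3"
      using S(1)[of w] by (simp add: divide_simps power3_eq_cube)
  qed (use S(1)[of w] in simp)
  have F: "((\<lambda>w. Q (w / S w)) has_real_derivative ?f w) (at w)" for w
  proof -
    have "1 - (w / S w)\<^sup>2 = 1 / (S w)\<^sup>2"
      using add_pos_nonneg[OF zero_less_one zero_le_power2[of w]]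
      by (simp add: power_divide S(2) divide_simps)
    then have "(1 - (w / S w)\<^sup>2) ^ m * H (w / S w) * (1 / S w ^ 3) = ?f w"
      by (simp add: power_divide power_add power_mult)
    with DERIV_chain2[OF Q(1) s'[of w]] show ?thesis by simp
  qed
  have lim: "((\<lambda>w. w / S w) \<longlongrightarrow> 1) at_top" "((\<lambda>w. w / S w) \<longlongrightarrow> - 1) at_bot"
    unfolding S_def by real_asymp+
  have Qlim: "((\<lambda>w. Q (w / S w)) \<longlongrightarrow> 0) at_top" "((\<lambda>w. Q (w / S w)) \<longlongrightarrow> 0) at_bot"
    using isCont_tendsto_compose[OF DERIV_isCont[OF Q(1)] lim(1)]
      isCont_tendsto_compose[OF DERIV_isCont[OF Q(1)] lim(2)] Q(2,3) by simp_all
  have "(LBINT w=-\<infinity>..\<infinity>. ?f w) = 0 - 0"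
  proof (rule interval_integral_FTC_integrable)
    show "((\<lambda>w. Q (w / S w)) has_vector_derivative ?f w) (at w)" for w
      using F by (simp add: has_real_derivative_iff_has_vector_derivative)
    show "isCont ?f w" for w
      using S(1)[of w] DERIV_isCont[OF S'] isCont_o2[OF DERIV_isCont[OF s'] H]
      by (intro isCont_divide isCont_power) auto
    show "set_integrable lborel (einterval (- \<infinity>) \<infinity>) ?f"
      using int by (simp add: set_integrable_def S_def)
    show "(((\<lambda>w. Q (w / S w)) \<circ> real_of_ereal) \<longlongrightarrow> 0) (at_right (- \<infinity>))"
         "(((\<lambda>w. Q (w / S w)) \<circ> real_of_ereal) \<longlongrightarrow> 0) (at_left \<infinity>)"
      using Qlim by (simp_all add: ereal_tendsto_simps)
  qed simp
  then show ?thesis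
    by (simp add: interval_lebesgue_integral_def set_lebesgue_integral_def S_def)
qed

section \<open>Radial functions with vanishing spherical means\<close>

lemma space_sphere_measure: "space (sphere_measure :: 'a::euclidean_space measure) = sphere 0 1"
  by (simp add: sphere_measure_def space_scale_measure space_restrict_space)

text \<open>
  For unit vectors \<open>p\<close> and \<open>\<theta>\<close> one has \<open>|p + t \<theta>|\<^sup>2 = 1 + t\<^sup>2 + 2 t s\<close> with \<open>s = p \<bullet> \<theta>\<close>, which runs
  from \<open>(1 - t)\<^sup>2\<close> at \<open>s = -1\<close> to \<open>(1 + t)\<^sup>2\<close> at \<open>s = 1\<close>.  The spherical mean is therefore a multiple of the integral
  of the derivative of order \<open>2 m + 1\<close> of a function that vanishes, with all its derivatives, at
  these values and beyond, against the polynomial weight \<open>(1 - s\<^sup>2)\<^bsup>m\<^esup>\<close> of degree \<open>2 m\<close>.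
\<close>

lemma spherical_mean_radial_eq_0:
  fixes p :: "'a::euclidean_space" and t :: real
  assumes dim: "DIM('a) = 2 * m + 3" and p: "norm p = 1" and t: "t > 0"
    and D: "\<And>j u. (D j has_real_derivative D (Suc j) u) (at u)"
    and supp: "\<And>j u. u \<notin> {(1 - t)\<^sup>2<..<(1 + t)\<^sup>2} \<Longrightarrow> D j u = 0"
  shows "spherical_mean (\<lambda>x. D (2 * m + 1) (x \<bullet> x)) p t = 0"
proof -
  define v where "v s = 1 + t\<^sup>2 + 2 * t * s" for s
  \<comment> \<open>the powers of \<open>2 t = dv/ds\<close> make \<open>E\<close> a sequence of successive derivatives in \<open>s\<close>\<close>
  define E where "E j s = (2 * t) ^ j * D j (v s)" for j s
  have E: "(E j has_real_derivative E (Suc j) s) (at s)" for j s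
  proof -
    have "(v has_real_derivative 2 * t) (at s)"
      unfolding v_def by (auto intro!: derivative_eq_intros)
    from DERIV_cmult[OF DERIV_chain2[OF D this], of "(2 * t) ^ j" j] show ?thesis
      unfolding E_def by (simp add: mult_ac)
  qed
  define H where "H = E (Suc (2 * m))"
  have H: "isCont H s" for s unfolding H_def by (rule DERIV_isCont[OF E])
  then have [measurable]: "H \<in> borel_measurable borel"
    by (intro borel_measurable_continuous_onI) (simp add: continuous_at_imp_continuous_on)
  have pm: "E j 1 = 0" "E j (- 1) = 0" for j
    using supp[of "v 1" j] supp[of "v (- 1)" j]
    by (simp_all add: E_def v_def power2_eq_square algebra_simps)
  have "H s = 0" if "s \<notin> {-1..1}" for s
  proof -
    have "v s \<notin> {(1 - t)\<^sup>2<..<(1 + t)\<^sup>2}"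
    proof (cases "s > 1")
      case True
      then have "2 * t * s \<ge> 2 * t" using t by simp
      then show ?thesis by (simp add: v_def power2_eq_square algebra_simps)
    next
      case False
      then have "2 * t * s \<le> 2 * t * (- 1)" using t that by (intro mult_left_mono) auto
      then show ?thesis by (simp add: v_def power2_eq_square algebra_simps)
    qed
    then show ?thesis by (simp add: H_def E_def supp)
  qed
  moreover have "bounded (H ` {-1..1})"
    using H by (intro compact_imp_bounded compact_continuous_image)
      (simp_all add: continuous_at_imp_continuous_on)
  then obtain B where B: "\<And>s. s \<in> {-1..1} \<Longrightarrow> \<bar>H s\<bar> \<le> B"
    unfolding bounded_iff by (metis image_eqI real_norm_def)
  moreover have "B \<ge> 0" using B[of 0] by simp
  ultimately have bound: "\<bar>H s\<bar> \<le> B" for s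
    by (cases "s \<in> {-1..1}") auto
  have dim': "DIM('a) = Suc (2 * m + 2)" using dim by simp
  let ?P = "[:1, 0, - 1:] ^ m :: real poly"
  have "degree ?P \<le> 2 * m"
    using degree_power_le[of "[:1, 0, - 1:] :: real poly" m] by simp
  then obtain Q where Q: "\<And>s. (Q has_real_derivative poly ?P s * H s) (at s)"
      "\<And>s. (\<And>j. E j s = 0) \<Longrightarrow> Q s = 0"
    using antiderivative_poly_mult_iterated_deriv[of E ?P "2 * m"] E unfolding H_def by metis
  have "(LINT w|lborel. H (w / sqrt (1 + w\<^sup>2)) / sqrt (1 + w\<^sup>2) ^ (2 * m + 3)) = 0"
  proof (rule integral_gnomonic_eq_0)
    show "(Q has_real_derivative (1 - s\<^sup>2) ^ m * H s) (at s)" for s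
      using Q(1)[of s] by (simp add: power2_eq_square)
    show "integrable lborel (\<lambda>w. H (w / sqrt (1 + w\<^sup>2)) / sqrt (1 + w\<^sup>2) ^ (2 * m + 3))"
      using integrable_gnomonic[where 'a = 'a and H = H and B = B, OF dim'] bound by (simp add: eval_nat_numeral)
  qed (auto intro: Q(2) pm H)
  then have zonal: "(LINT \<theta>|sphere_measure. H (p \<bullet> \<theta>)) = 0"
    by (subst integral_sphere_zonal[OF p dim']) (simp_all add: eval_nat_numeral)
  have "(LINT \<theta>|sphere_measure. D (2 * m + 1) ((p + t *\<^sub>R \<theta>) \<bullet> (p + t *\<^sub>R \<theta>))) =
        (LINT \<theta>|sphere_measure. H (p \<bullet> \<theta>) / (2 * t) ^ (2 * m + 1))"
  proof (rule Bochner_Integration.integral_cong[OF refl])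
    fix \<theta> :: 'a assume "\<theta> \<in> space sphere_measure"
    then have "\<theta> \<bullet> \<theta> = 1" by (simp add: space_sphere_measure norm_eq_1)
    moreover have "p \<bullet> p = 1" using p by (simp add: norm_eq_1)
    ultimately have "(p + t *\<^sub>R \<theta>) \<bullet> (p + t *\<^sub>R \<theta>) = v (p \<bullet> \<theta>)"
      by (simp add: v_def inner_add_left inner_add_right inner_commute power2_eq_square algebra_simps)
    then show "D (2 * m + 1) ((p + t *\<^sub>R \<theta>) \<bullet> (p + t *\<^sub>R \<theta>)) = H (p \<bullet> \<theta>) / (2 * t) ^ (2 * m + 1)"
      using t by (simp add: H_def E_def)
  qed
  then show ?thesis by (simp add: spherical_mean_def zonal)
qed

theorem theorem1p6:
  fixes \<epsilon> :: real
  assumes "CARD('n::finite) \<ge> 3" and "odd CARD('n)"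
    and "0 < \<epsilon>" and "\<epsilon> < 1"
  shows "\<exists>f \<in> test_functions (ball (0 :: real ^ 'n) 1).
           (\<exists>x. f x \<noteq> 0) \<and>
           (\<forall>x \<in> ball 0 \<epsilon>. f x = 0) \<and>
           (\<forall>p \<in> sphere 0 1. \<forall>t \<in> {1 - \<epsilon><..<1 + \<epsilon>}. spherical_mean f p t = 0)"
proof -
  obtain m where m: "CARD('n) = 2 * m + 3"
  proof -
    obtain l where l: "CARD('n) = 2 * l + 1" using assms(2) by (rule oddE)
    then have "CARD('n) = 2 * (l - 1) + 3" using assms(1) by linarith
    then show ?thesis by (rule that)
  qed
  have "\<epsilon>\<^sup>2 < 1" using assms(3,4) by (simp add: abs_square_less_1)
  \<comment> \<open>two points that trisect the interval from \<open>\<epsilon>\<^sup>2\<close> to \<open>1\<close>\<close>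
  define a b where "a = (2 * \<epsilon>\<^sup>2 + 1) / 3" and "b = (\<epsilon>\<^sup>2 + 2) / 3"
  have ab: "\<epsilon>\<^sup>2 < a" "a < b" "b < 1" "a > 0"
    using \<open>\<epsilon>\<^sup>2 < 1\<close> by (auto simp: a_def b_def add_nonneg_pos)
  define D where "D j = (deriv ^^ j) (bump a b)" for j
  have D: "smooth_expr (D j)" "(D j has_real_derivative D (Suc j) u) (at u)" for j u
    using smooth_expr_deriv_funpow[OF smooth_expr_bump] smooth_expr_deriv(2)
    by (auto simp: D_def)
  have supp: "D j u = 0" if "u \<notin> {a..b}" for j u
    using that ab(2) unfolding D_def by (intro deriv_funpow_bump_eq_0) auto
  define f where "f x = D (2 * m + 1) (x \<bullet> x)" for x :: "real ^ 'n"
  let ?A = "{x :: real ^ 'n. x \<bullet> x \<in> {a..b}}"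
  have f: "closure {x. f x \<noteq> 0} \<subseteq> ?A"
  proof (rule closure_minimal)
    show "{x. f x \<noteq> 0} \<subseteq> ?A" using supp by (auto simp: f_def)
    have "closed ((\<lambda>x :: real ^ 'n. x \<bullet> x) -` {a..b})"
      by (intro closed_vimage continuous_intros)
    then show "closed ?A" by (simp add: vimage_def)
  qed
  have A: "?A \<subseteq> ball 0 1"
    using ab(3) by (auto simp: norm_lt_square[of _ 1] dist_norm norm_eq_sqrt_inner)
  have "f \<in> test_functions (ball 0 1)"
    unfolding test_functions_def
  proof (intro CollectI conjI)
    have "smooth_expr f"
      unfolding f_def by (rule smooth_expr_compose[OF D(1) smooth_expr_inner_self])
    then show "smooth_on (ball 0 1) f" by (rule smooth_expr_imp_smooth_on)
    show *: "closure {x. f x \<noteq> 0} \<subseteq> ball 0 1" using f A by blast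
    then show "compact (closure {x. f x \<noteq> 0})"
      using bounded_subset[OF bounded_ball] by (auto simp: compact_eq_bounded_closed)
  qed
  moreover have "\<exists>x. f x \<noteq> 0"
  proof -
    obtain u where u: "u \<in> {a..b}" "D (2 * m + 1) u \<noteq> 0"
      using deriv_funpow_bump_nonzero[OF ab(2)] unfolding D_def by blast
    obtain e :: "real ^ 'n" where e: "e \<in> Basis" using nonempty_Basis by blast
    have "(sqrt u *\<^sub>R e) \<bullet> (sqrt u *\<^sub>R e) = u" using e u(1) ab(4) by simp
    with u(2) show ?thesis unfolding f_def by metis
  qed
  moreover have "f x = 0" if "x \<in> ball 0 \<epsilon>" for x
  proof -
    have "x \<bullet> x < \<epsilon>\<^sup>2" using that by (simp add: norm_lt_square)
    then show ?thesis using ab(1) supp by (simp add: f_def)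
  qed
  moreover have "spherical_mean f p t = 0"
    if "p \<in> sphere 0 1" "t \<in> {1 - \<epsilon><..<1 + \<epsilon>}" for p t
    unfolding f_def
  proof (rule spherical_mean_radial_eq_0)
    show "D j u = 0" if "u \<notin> {(1 - t)\<^sup>2<..<(1 + t)\<^sup>2}" for j u
    proof (rule supp)
      \<comment> \<open>the sphere reaches below the shell at its nearest point and beyond it at its farthest\<close>
      have "(1 - t)\<^sup>2 < \<epsilon>\<^sup>2"
        using \<open>t \<in> _\<close> assms(3) by (intro power2_strict_mono) auto
      moreover have "1 < (1 + t)\<^sup>2"
        using \<open>t \<in> _\<close> assms(4) by (intro one_less_power) auto
      ultimately show "u \<notin> {a..b}" using that ab by auto
    qed
  qed (use that D m assms(4) in auto)
  ultimately show ?thesis by blast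
qed

end
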